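(* Let $A\subseteq B$ be an integral extension of rings with $A$ Hensel local. Then for all rings $C$ with $A\subseteq C\subseteq B$ the map $\varphi(A,C,B):\mathcal{I}(A,B)\to\mathcal{I}(C,B)$, $I\mapsto IC$, is surjective.
   Context: All rings are commutative with $1$ and ring homomorphisms are unitary. For a ring extension $A\subseteq B$, an $A$-submodule $I$ of $B$ is invertible if there is an $A$-submodule $J$ of $B$ with $IJ=A$; $\mathcal{I}(A,B)$ is the group, under multiplication, of invertible $A$-submodules of $B$. A local ring $A$ is Hensel if every finite $A$-algebra is a direct product of local rings. *)

theory Defs
  imports
    "HOL-Algebra.Chinese_Remainder"
    "HOL-Algebra.Ideal_Product"
    "HOL-Algebra.Module"
    "HOL-Algebra.Polynomials"
begin

section \<open>Hensel local rings\<close>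

definition local_ring :: "('a, 'm) ring_scheme \<Rightarrow> bool" where
  "local_ring R \<longleftrightarrow> cring R \<and> (\<exists>!\<mm>. maximalideal \<mm> R)"

definition finite_algebra :: "('a, 'm) ring_scheme \<Rightarrow> ('a, 'b, 'n) module_scheme \<Rightarrow> bool" where
  "finite_algebra R M \<longleftrightarrow> algebra R M \<and>
     (\<exists>S. finite S \<and> S \<subseteq> carrier M \<and>
        (\<forall>x\<in>carrier M. \<exists>c\<in>S \<rightarrow> carrier R. x = (\<Oplus>\<^bsub>M\<^esub>s\<in>S. c s \<odot>\<^bsub>M\<^esub> s)))"

text \<open>
  The algebras range over the fixed carrier type \<^typ>\<open>'a list set\<close>, because a definition cannot
  quantify over types. Nothing is lost: an algebra generated by \<open>n\<close> elements is a quotient of the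
  module of lists of length \<open>n\<close>, so it has a copy on this type (see \<open>hensel_local_ring_finite_algebra\<close>
  below). The factors of a direct product embed into it, so they have copies on the same type.
  The empty product is the zero ring.
\<close>

definition hensel_local_ring :: "('a, 'm) ring_scheme \<Rightarrow> bool" where
  "hensel_local_ring R \<longleftrightarrow> local_ring R \<and>
     (\<forall>M :: ('a, 'a list set) module. finite_algebra R M \<longrightarrow>
        (\<exists>Rs :: 'a list set ring list. (\<forall>L\<in>set Rs. local_ring L) \<and> M \<simeq> RDirProd_list Rs))"

lemma finite_algebra_transfer:
  fixes N :: "('a, 'c, 'k) module_scheme"
  assumes fin: "finite_algebra R M" and h: "h \<in> ring_iso M N" and N: "cring N"
    and sm: "\<And>a x. a \<in> carrier R \<Longrightarrow> x \<in> carrier M \<Longrightarrow> h (a \<odot>\<^bsub>M\<^esub> x) = a \<odot>\<^bsub>N\<^esub> h x"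
  shows "finite_algebra R N"
proof -
  interpret M: algebra R M using fin by (simp add: finite_algebra_def)
  interpret N: cring N by (rule N)
  have hom: "h \<in> ring_hom M N" and bij: "bij_betw h (carrier M) (carrier N)"
    using h by (auto simp: ring_iso_def)
  interpret H: ring_hom_cring M N h
    using hom by (intro ring_hom_cring.intro ring_hom_cring_axioms.intro M.M_cring N)
  have im: "carrier N = h ` carrier M" using bij by (simp add: bij_betw_def)
  have alg: "algebra R N"
    apply (rule algebraI[OF M.R_cring N])
    apply (auto simp: im sm[symmetric] M.smult_l_distr M.smult_r_distr M.smult_assoc1 M.smult_assoc2
        H.hom_add[symmetric] H.hom_mult[symmetric] simp del: H.hom_add H.hom_mult)
    done
  obtain S where S: "finite S" "S \<subseteq> carrier M"
    and gen: "\<And>x. x \<in> carrier M \<Longrightarrow> \<exists>c\<in>S \<rightarrow> carrier R. x = (\<Oplus>\<^bsub>M\<^esub>s\<in>S. c s \<odot>\<^bsub>M\<^esub> s)"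
    using fin unfolding finite_algebra_def by blast
  have inj: "inj_on h S" using bij S(2) by (meson bij_betw_def inj_on_subset)
  have "\<exists>c\<in>h ` S \<rightarrow> carrier R. h x = (\<Oplus>\<^bsub>N\<^esub>t\<in>h ` S. c t \<odot>\<^bsub>N\<^esub> t)" if x: "x \<in> carrier M" for x
  proof -
    obtain c where c: "c \<in> S \<rightarrow> carrier R" "x = (\<Oplus>\<^bsub>M\<^esub>s\<in>S. c s \<odot>\<^bsub>M\<^esub> s)" using gen[OF x] by blast
    let ?g = "inv_into S h"
    have "h x = (\<Oplus>\<^bsub>N\<^esub>s\<in>S. h (c s \<odot>\<^bsub>M\<^esub> s))"
      unfolding c(2) using c(1) S by (subst H.hom_finsum) (auto simp: o_def Pi_iff)
    also have "\<dots> = (\<Oplus>\<^bsub>N\<^esub>s\<in>S. c (?g (h s)) \<odot>\<^bsub>N\<^esub> h s)"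
      using c(1) S inj by (intro N.finsum_cong') (auto simp: Pi_iff sm[symmetric] subset_iff)
    also have "\<dots> = (\<Oplus>\<^bsub>N\<^esub>t\<in>h ` S. c (?g t) \<odot>\<^bsub>N\<^esub> t)"
      using c(1) S inj by (intro N.finsum_reindex[symmetric]) (auto simp: Pi_iff sm[symmetric] subset_iff)
    finally show ?thesis using c(1) inj by (intro bexI[of _ "\<lambda>t. c (?g t)"]) auto
  qed
  then show ?thesis unfolding finite_algebra_def im using alg S
    by (intro conjI exI[of _ "h ` S"]) auto
qed

lemma hensel_local_ring_finite_algebra:
  fixes R :: "('a, 'm) ring_scheme" and M :: "('a, 'c, 'k) module_scheme"
  assumes hens: "hensel_local_ring R" and fin: "finite_algebra R M"
  shows "\<exists>Rs :: 'a list set ring list. (\<forall>L\<in>set Rs. local_ring L) \<and> M \<simeq> RDirProd_list Rs"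
proof -
  interpret M: algebra R M using fin by (simp add: finite_algebra_def)
  obtain S where S: "finite S" "S \<subseteq> carrier M"
    and gen: "\<And>x. x \<in> carrier M \<Longrightarrow> \<exists>c\<in>S \<rightarrow> carrier R. x = (\<Oplus>\<^bsub>M\<^esub>s\<in>S. c s \<odot>\<^bsub>M\<^esub> s)"
    using fin unfolding finite_algebra_def by blast
  obtain es where es: "set es = S" using S(1) finite_list by blast
  obtain c where c: "\<And>x. x \<in> carrier M \<Longrightarrow> c x \<in> S \<rightarrow> carrier R"
      "\<And>x. x \<in> carrier M \<Longrightarrow> x = (\<Oplus>\<^bsub>M\<^esub>s\<in>S. c x s \<odot>\<^bsub>M\<^esub> s)"
    using gen by metis
  define h :: "'c \<Rightarrow> 'a list set" where "h x = {map (c x) es}" for x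
  have inj: "inj_on h (carrier M)"
  proof (rule inj_onI)
    fix x y assume xy: "x \<in> carrier M" "y \<in> carrier M" "h x = h y"
    then have eq: "\<forall>s\<in>S. c x s = c y s" by (auto simp: h_def es)
    have "x = (\<Oplus>\<^bsub>M\<^esub>s\<in>S. c x s \<odot>\<^bsub>M\<^esub> s)" using c(2) xy by blast
    also have "\<dots> = (\<Oplus>\<^bsub>M\<^esub>s\<in>S. c y s \<odot>\<^bsub>M\<^esub> s)"
      using eq c(1)[OF xy(2)] S by (intro M.finsum_cong') (auto simp: Pi_iff)
    also have "\<dots> = y" using c(2) xy by metis
    finally show "x = y" .
  qed
  define I where "I = image_ring h M"
  define N :: "('a, 'a list set) module" where
    "N = \<lparr>carrier = carrier I, monoid.mult = monoid.mult I, one = one I, zero = zero I, add = add I,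
          smult = (\<lambda>a y. h (a \<odot>\<^bsub>M\<^esub> inv_into (carrier M) h y))\<rparr>"
  have isoI: "h \<in> ring_iso M I" unfolding I_def by (rule inj_imp_image_ring_iso[OF inj])
  then have iso: "h \<in> ring_iso M N" by (simp add: N_def ring_iso_def ring_hom_def)
  have "N\<lparr>zero := h \<zero>\<^bsub>M\<^esub>\<rparr> = N"
    by (simp add: N_def I_def image_ring_zero)
  then have N: "cring N" using M.ring_iso_imp_img_cring[OF iso] by simp
  have "finite_algebra R N"
    by (rule finite_algebra_transfer[OF fin iso N]) (simp add: N_def inv_into_f_f[OF inj])
  then obtain Rs :: "'a list set ring list"
    where "\<forall>L\<in>set Rs. local_ring L" "N \<simeq> RDirProd_list Rs"
    using hens unfolding hensel_local_ring_def by blast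
  moreover have "M \<simeq> N" using iso by (auto simp: is_ring_iso_def)
  ultimately show ?thesis using ring_iso_trans by blast
qed


section \<open>Integral extensions\<close>

text \<open>Polynomials are coefficient lists with the leading coefficient first, so
  \<open>\<one>\<^bsub>B\<^esub> # as\<close> runs over the monic polynomials with coefficients in \<open>A\<close>.\<close>

definition integral_extension :: "'b set \<Rightarrow> ('b, 'm) ring_scheme \<Rightarrow> bool" where
  "integral_extension A B \<longleftrightarrow> subring A B \<and>
     (\<forall>b\<in>carrier B. \<exists>as. set as \<subseteq> A \<and> ring.eval B (\<one>\<^bsub>B\<^esub> # as) b = \<zero>\<^bsub>B\<^esub>)"


section \<open>Invertible submodules of a ring extension\<close>

definition self_module :: "('b, 'm) ring_scheme \<Rightarrow> ('b, 'b) module" where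
  "self_module B = \<lparr>carrier = carrier B, monoid.mult = monoid.mult B, one = \<one>\<^bsub>B\<^esub>, zero = \<zero>\<^bsub>B\<^esub>, add = add B,
     smult = monoid.mult B\<rparr>"

abbreviation submodule_of_ext :: "'b set \<Rightarrow> 'b set \<Rightarrow> ('b, 'm) ring_scheme \<Rightarrow> bool" where
  "submodule_of_ext I A B \<equiv> submodule I (B\<lparr>carrier := A\<rparr>) (self_module B)"

text \<open>\<open>ideal_prod B I J\<close>, written \<open>I \<cdot>\<^bsub>B\<^esub> J\<close>, is the set of nonempty finite sums of products
  \<open>i \<otimes> j\<close> for arbitrary subsets \<open>I\<close>, \<open>J\<close> of \<open>B\<close>; it is the product of submodules.\<close>

definition invertible_submodules :: "'b set \<Rightarrow> ('b, 'm) ring_scheme \<Rightarrow> 'b set monoid" where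
  "invertible_submodules A B =
     \<lparr>carrier = {I. submodule_of_ext I A B \<and> (\<exists>J. submodule_of_ext J A B \<and> I \<cdot>\<^bsub>B\<^esub> J = A)},
      monoid.mult = ideal_prod B, one = A\<rparr>"

lemma submodule_of_ext_iff:
  "submodule_of_ext I A B \<longleftrightarrow>
    subgroup I (add_monoid B) \<and> (\<forall>a\<in>A. \<forall>x\<in>I. a \<otimes>\<^bsub>B\<^esub> x \<in> I)"
  by (auto simp: self_module_def submodule_def submodule_axioms_def subgroup_def m_inv_def)

lemma ideal_prod_subset:
  assumes "subgroup K (add_monoid B)" and "\<And>i j. i \<in> I \<Longrightarrow> j \<in> J \<Longrightarrow> i \<otimes>\<^bsub>B\<^esub> j \<in> K"
  shows "I \<cdot>\<^bsub>B\<^esub> J \<subseteq> K"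
proof
  fix x assume "x \<in> I \<cdot>\<^bsub>B\<^esub> J"
  then show "x \<in> K"
    by induct (use assms subgroup.m_closed[OF assms(1)] in auto)
qed

lemma (in cring) ideal_prod_submodule_of_ext:
  assumes A: "A \<subseteq> carrier R" and I: "submodule_of_ext I A R" and J: "subgroup J (add_monoid R)"
  shows "submodule_of_ext (I \<cdot> J) A R"
proof -
  have I': "subgroup I (add_monoid R)" "\<And>a x. a \<in> A \<Longrightarrow> x \<in> I \<Longrightarrow> a \<otimes> x \<in> I"
    using I by (auto simp: submodule_of_ext_iff)
  have car: "I \<subseteq> carrier R" "J \<subseteq> carrier R"
    using subgroup.subset[OF I'(1)] subgroup.subset[OF J] by auto
  have sub: "I \<cdot> J \<subseteq> carrier R"
    by (rule ideal_prod_subset) (use car in \<open>auto simp: add.subgroup_self\<close>)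
  have zero: "\<zero> \<in> I \<cdot> J"
    using ideal_prod.prod[of \<zero> I \<zero> J R] subgroup.one_closed[OF I'(1)] subgroup.one_closed[OF J] by simp
  have neg: "\<ominus> x \<in> I \<cdot> J" if "x \<in> I \<cdot> J" for x using that
  proof induct
    case (prod i j)
    have "\<ominus> (i \<otimes> j) = (\<ominus> i) \<otimes> j" using prod car by (simp add: l_minus subset_iff)
    moreover have "\<ominus> i \<in> I" using subgroup.m_inv_closed[OF I'(1) prod(1)] by (simp add: a_inv_def)
    ultimately show ?case using prod(2) by (simp add: ideal_prod.prod)
  next
    case (sum x y)
    then have "\<ominus> (x \<oplus> y) = \<ominus> x \<oplus> \<ominus> y" using sub by (simp add: minus_add subset_iff)
    then show ?case using sum by (simp add: ideal_prod.sum)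
  qed
  have sm: "a \<otimes> x \<in> I \<cdot> J" if a: "a \<in> A" and "x \<in> I \<cdot> J" for a x using that(2)
  proof induct
    case (prod i j)
    have "a \<otimes> (i \<otimes> j) = (a \<otimes> i) \<otimes> j" using prod car a A by (simp add: m_assoc subset_iff)
    then show ?case using prod I'(2)[OF a] by (simp add: ideal_prod.prod)
  next
    case (sum x y)
    then have "a \<otimes> (x \<oplus> y) = a \<otimes> x \<oplus> a \<otimes> y" using sub a A by (simp add: r_distr subset_iff)
    then show ?case using sum by (simp add: ideal_prod.sum)
  qed
  have "subgroup (I \<cdot> J) (add_monoid R)"
    by (rule add.subgroupI) (use sub zero neg ideal_prod.sum in \<open>auto simp: a_inv_def[symmetric]\<close>)
  then show ?thesis using sm by (simp add: submodule_of_ext_iff)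
qed

lemma (in cring) ideal_prod_comm_subset:
  assumes "I \<subseteq> carrier R" "J \<subseteq> carrier R"
  shows "I \<cdot> J = J \<cdot> I"
proof -
  have "I \<cdot> J \<subseteq> J \<cdot> I" if "I \<subseteq> carrier R" "J \<subseteq> carrier R" for I J
  proof
    fix x assume "x \<in> I \<cdot> J"
    then show "x \<in> J \<cdot> I"
    proof induct
      case (prod i j)
      then have "i \<otimes> j = j \<otimes> i" using that by (simp add: m_comm subset_iff)
      then show ?case using prod by (simp add: ideal_prod.prod)
    qed (rule ideal_prod.sum)
  qed
  then show ?thesis using assms by blast
qed

lemma (in cring) ideal_prod_assoc_subgroup:
  assumes I: "subgroup I (add_monoid R)" and J: "subgroup J (add_monoid R)" and K: "subgroup K (add_monoid R)"
  shows "(I \<cdot> J) \<cdot> K = I \<cdot> (J \<cdot> K)"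
proof -
  have sg: "subgroup (U \<cdot> V) (add_monoid R)"
    if "subgroup U (add_monoid R)" "subgroup V (add_monoid R)" for U V
    using ideal_prod_submodule_of_ext[of "{}" U V] that by (simp add: submodule_of_ext_iff)
  have le: "(I \<cdot> J) \<cdot> K \<subseteq> I \<cdot> (J \<cdot> K)"
    if I: "subgroup I (add_monoid R)" and J: "subgroup J (add_monoid R)" and K: "subgroup K (add_monoid R)" for I J K
  proof (rule ideal_prod_subset[OF sg[OF I sg[OF J K]]])
    have car: "I \<subseteq> carrier R" "J \<subseteq> carrier R" "K \<subseteq> carrier R" "I \<cdot> J \<subseteq> carrier R"
      using subgroup.subset[OF I] subgroup.subset[OF J] subgroup.subset[OF K]
        subgroup.subset[OF sg[OF I J]] by auto
    fix x k assume "x \<in> I \<cdot> J" and k: "k \<in> K"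
    then show "x \<otimes> k \<in> I \<cdot> (J \<cdot> K)"
    proof (induct x)
      case (prod i j)
      have "(i \<otimes> j) \<otimes> k = i \<otimes> (j \<otimes> k)" using prod k car by (simp add: m_assoc subset_iff)
      then show ?case using prod k by (simp add: ideal_prod.prod)
    next
      case (sum x y)
      then have "(x \<oplus> y) \<otimes> k = x \<otimes> k \<oplus> y \<otimes> k" using car k by (simp add: l_distr subset_iff)
      then show ?case using sum k by (simp add: ideal_prod.sum)
    qed
  qed
  have sub: "U \<subseteq> carrier R" if "subgroup U (add_monoid R)" for U
    using subgroup.subset[OF that] by simp
  have "I \<cdot> (J \<cdot> K) = (K \<cdot> J) \<cdot> I"
    using sub[OF I] sub[OF J] sub[OF K] sub[OF sg[OF J K]] sub[OF sg[OF K J]]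
    by (simp add: ideal_prod_comm_subset[of J K] ideal_prod_comm_subset[of I])
  also have "\<dots> \<subseteq> K \<cdot> (J \<cdot> I)" by (rule le[OF K J I])
  also have "\<dots> = (I \<cdot> J) \<cdot> K"
    using sub[OF I] sub[OF J] sub[OF K] sub[OF sg[OF J I]] sub[OF sg[OF I J]]
    by (simp add: ideal_prod_comm_subset[of J I] ideal_prod_comm_subset[of K])
  finally show ?thesis using le[OF I J K] by blast
qed

lemma (in cring) comm_group_invertible_submodules:
  assumes A: "subring A R"
  shows "comm_group (invertible_submodules A R)"
proof -
  note Aprops = subringE[OF A]
  have sgA: "subgroup A (add_monoid R)" using A by (simp add: subring_def)
  have modA: "submodule_of_ext A A R" using sgA Aprops by (simp add: submodule_of_ext_iff)
  have sgD: "subgroup I (add_monoid R)" "I \<subseteq> carrier R" if "submodule_of_ext I A R" for I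
    using that subgroup.subset[of I "add_monoid R"] by (auto simp: submodule_of_ext_iff)
  have AI: "A \<cdot> I = I" if I: "submodule_of_ext I A R" for I
  proof
    show "A \<cdot> I \<subseteq> I" using I by (intro ideal_prod_subset) (auto simp: submodule_of_ext_iff)
    show "I \<subseteq> A \<cdot> I"
    proof
      fix x assume x: "x \<in> I"
      then have "\<one> \<otimes> x \<in> A \<cdot> I" using Aprops by (intro ideal_prod.prod)
      then show "x \<in> A \<cdot> I" using x sgD(2)[OF I] by (simp add: subset_iff)
    qed
  qed
  have mod: "submodule_of_ext (I \<cdot> J) A R" if "submodule_of_ext I A R" "submodule_of_ext J A R" for I J
    using ideal_prod_submodule_of_ext[OF Aprops(1) that(1) sgD(1)[OF that(2)]] .
  have comm: "I \<cdot> J = J \<cdot> I" if "submodule_of_ext I A R" "submodule_of_ext J A R" for I J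
    using ideal_prod_comm_subset sgD(2) that by blast
  have assoc: "(I \<cdot> J) \<cdot> K = I \<cdot> (J \<cdot> K)"
    if "submodule_of_ext I A R" "submodule_of_ext J A R" "submodule_of_ext K A R" for I J K
    using ideal_prod_assoc_subgroup sgD(1) that by blast
  show ?thesis
  proof (rule comm_groupI)
    fix I J
    assume "I \<in> carrier (invertible_submodules A R)" "J \<in> carrier (invertible_submodules A R)"
    then obtain I' J' where h: "submodule_of_ext I A R" "submodule_of_ext J A R"
      "submodule_of_ext I' A R" "submodule_of_ext J' A R" "I \<cdot> I' = A" "J \<cdot> J' = A"
      by (auto simp: invertible_submodules_def)
    have "(I \<cdot> J) \<cdot> (J' \<cdot> I') = I \<cdot> ((J \<cdot> J') \<cdot> I')"
      using assoc[OF h(1,2) mod[OF h(4,3)]] assoc[OF h(2,4,3)] by simp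
    also have "\<dots> = A" using h AI by simp
    finally have inv: "(I \<cdot> J) \<cdot> (J' \<cdot> I') = A" .
    show "I \<otimes>\<^bsub>invertible_submodules A R\<^esub> J \<in> carrier (invertible_submodules A R)"
      using mod[OF h(1,2)] mod[OF h(4,3)] inv by (simp add: invertible_submodules_def) blast
  next
    fix I assume "I \<in> carrier (invertible_submodules A R)"
    then obtain I' where h: "submodule_of_ext I A R" "submodule_of_ext I' A R" "I \<cdot> I' = A"
      by (auto simp: invertible_submodules_def)
    then have "I' \<cdot> I = A" using comm by metis
    then show "\<exists>J\<in>carrier (invertible_submodules A R).
        J \<otimes>\<^bsub>invertible_submodules A R\<^esub> I = \<one>\<^bsub>invertible_submodules A R\<^esub>"
      using h by (auto simp: invertible_submodules_def)
  qed (use modA AI comm assoc in \<open>auto simp: invertible_submodules_def\<close>)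
qed

end

theory Submission
  imports Defs
begin

text \<open>
  If \<open>I J = C\<close>, it suffices to find \<open>u \<in> I\<close> and \<open>v \<in> J\<close> with \<open>u v = 1\<close>: then \<open>I = C u\<close> is the
  extension of \<open>A u\<close>. Such a pair exists because \<open>C\<close> is an exchange ring: whenever \<open>z + w = 1\<close> in
  \<open>C\<close>, some multiples of \<open>z\<close> and \<open>w\<close> are orthogonal idempotents with sum \<open>1\<close>. Local rings
  clearly have this property, it passes to direct products, and hence every finite subalgebra
  \<open>A[z]\<close> of \<open>C\<close> has it by the Hensel property. Writing \<open>1 \<in> I J\<close> as a sum of products and
  splitting \<open>1\<close> by the exchange property, one finds orthogonal idempotents \<open>e\<^sub>k\<close> with sum \<open>1\<close>, each of
  the form \<open>u\<^sub>k v\<^sub>k\<close>; glue these with the \<open>e\<^sub>k\<close>.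
\<close>

section \<open>Exchange rings\<close>

text \<open>Idempotency of the two multiples is automatic: if \<open>p q = 0\<close> and
  \<open>p + q = 1\<close>, then \<open>p p = p (p + q) = p\<close>. The purely equational form
  passes directly through isomorphisms and to pairs.\<close>

definition exchange_ring :: "('a, 'm) ring_scheme \<Rightarrow> bool" where
  "exchange_ring R \<longleftrightarrow>
     (\<forall>z\<in>carrier R. \<forall>w\<in>carrier R. z \<oplus>\<^bsub>R\<^esub> w = \<one>\<^bsub>R\<^esub> \<longrightarrow>
       (\<exists>c\<in>carrier R. \<exists>d\<in>carrier R. (c \<otimes>\<^bsub>R\<^esub> z) \<otimes>\<^bsub>R\<^esub> (d \<otimes>\<^bsub>R\<^esub> w) = \<zero>\<^bsub>R\<^esub> \<and>
          (c \<otimes>\<^bsub>R\<^esub> z) \<oplus>\<^bsub>R\<^esub> (d \<otimes>\<^bsub>R\<^esub> w) = \<one>\<^bsub>R\<^esub>))"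

text \<open>Zorn's lemma applies because properness is expressed by
  \<open>\<one> \<notin> J\<close>, a condition that survives unions of chains.\<close>

lemma (in ring) exists_maximalideal:
  assumes I: "ideal I R" and "\<one> \<notin> I"
  shows "\<exists>M. maximalideal M R \<and> I \<subseteq> M"
proof -
  define S where "S = {J. ideal J R \<and> I \<subseteq> J \<and> \<one> \<notin> J}"
  have "\<exists>M\<in>S. \<forall>J\<in>S. M \<subseteq> J \<longrightarrow> J = M"
  proof (rule subset_Zorn_nonempty)
    show "S \<noteq> {}" using assms by (auto simp: S_def)
    fix C assume C: "C \<noteq> {}" "subset.chain S C"
    then have "subset.chain {J. ideal J R} C" by (auto simp: S_def pred_on.chain_def)
    then have "ideal (\<Union>C) R" using chain_Union_is_ideal[of C] C(1) by simp
    then show "\<Union>C \<in> S" using C by (auto simp: S_def pred_on.chain_def)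
  qed
  then obtain M where M: "M \<in> S" "\<And>J. J \<in> S \<Longrightarrow> M \<subseteq> J \<Longrightarrow> J = M" by auto
  have "maximalideal M R"
  proof (rule maximalidealI)
    show "ideal M R" "carrier R \<noteq> M" using M(1) by (auto simp: S_def)
    fix J assume J: "ideal J R" "M \<subseteq> J" "J \<subseteq> carrier R"
    show "J = M \<or> J = carrier R"
    proof (cases "\<one> \<in> J")
      case True
      then show ?thesis using ideal.one_imp_carrier[OF J(1)] by simp
    next
      case False
      then show ?thesis using M J by (auto simp: S_def)
    qed
  qed
  then show ?thesis using M(1) by (auto simp: S_def)
qed

text \<open>If neither \<open>z\<close> nor \<open>w\<close> were a unit, both would lie in the
  unique maximal ideal, and so would their sum \<open>\<one>\<close>. Hence one of them can be
  scaled to \<open>\<one>\<close> and the other to \<open>\<zero>\<close>.\<close>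

lemma local_ring_exchange_ring:
  fixes R (structure)
  assumes "local_ring R"
  shows "exchange_ring R"
proof -
  interpret cring R using assms by (simp add: local_ring_def)
  have unit: "(\<exists>c\<in>carrier R. c \<otimes> z = \<one>) \<or> (\<exists>c\<in>carrier R. c \<otimes> w = \<one>)"
    if zw: "z \<in> carrier R" "w \<in> carrier R" "z \<oplus> w = \<one>" for z w
  proof (rule ccontr)
    assume no: "\<not> ((\<exists>c\<in>carrier R. c \<otimes> z = \<one>) \<or> (\<exists>c\<in>carrier R. c \<otimes> w = \<one>))"
    have ex: "\<exists>M. maximalideal M R \<and> x \<in> M"
      if x: "x \<in> carrier R" "\<not> (\<exists>c\<in>carrier R. c \<otimes> x = \<one>)" for x
    proof -
      have "\<one> \<notin> PIdl x" using x(2) by (auto simp: cgenideal_def)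
      then show ?thesis
        using exists_maximalideal[OF cgenideal_ideal[OF x(1)]] cgenideal_self[OF x(1)] by blast
    qed
    obtain M where M: "maximalideal M R" "z \<in> M" using ex[OF zw(1)] no by blast
    obtain N where N: "maximalideal N R" "w \<in> N" using ex[OF zw(2)] no by blast
    \<comment> \<open>Uniqueness of the maximal ideal identifies \<open>N\<close> with
      \<open>M\<close>.\<close>
    have "w \<in> M" using assms M(1) N unfolding local_ring_def by blast
    interpret M: maximalideal M R by (rule M(1))
    have "\<one> \<in> M" using M.a_closed[OF M(2) \<open>w \<in> M\<close>] zw(3) by simp
    then show False using M.one_imp_carrier M.I_notcarr by simp
  qed
  show ?thesis unfolding exchange_ring_def
  proof (intro ballI impI)
    fix z w assume zw: "z \<in> carrier R" "w \<in> carrier R" "z \<oplus> w = \<one>"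
    from unit[OF zw] show "\<exists>c\<in>carrier R. \<exists>d\<in>carrier R.
      (c \<otimes> z) \<otimes> (d \<otimes> w) = \<zero> \<and> (c \<otimes> z) \<oplus> (d \<otimes> w) = \<one>"
    proof
      assume "\<exists>c\<in>carrier R. c \<otimes> z = \<one>"
      then obtain c where "c \<in> carrier R" "c \<otimes> z = \<one>" by blast
      then show ?thesis using zw by (intro bexI[of _ c] bexI[of _ \<zero>]) auto
    next
      assume "\<exists>c\<in>carrier R. c \<otimes> w = \<one>"
      then obtain c where "c \<in> carrier R" "c \<otimes> w = \<one>" by blast
      then show ?thesis using zw by (intro bexI[of _ \<zero>] bexI[of _ c]) auto
    qed
  qed
qed

section \<open>Isomorphisms and finite direct products of exchange rings\<close>

lemma exchange_ring_iso:
  assumes "ring R" "ring S" "h \<in> ring_iso R S" "exchange_ring S"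
  shows "exchange_ring R"
proof -
  interpret R: ring R by fact
  interpret S: ring S by fact
  have bij: "bij_betw h (carrier R) (carrier S)" using assms(3) by (simp add: ring_iso_def)
  interpret h: ring_hom_ring R S h
    using assms(3) by (intro ring_hom_ring.intro ring_hom_ring_axioms.intro R.ring_axioms S.ring_axioms)
      (simp add: ring_iso_def)
  have inj: "x = y" if "h x = h y" "x \<in> carrier R" "y \<in> carrier R" for x y
    using bij that by (meson bij_betw_def inj_onD)
  show ?thesis unfolding exchange_ring_def
  proof (intro ballI impI)
    fix z w assume zw: "z \<in> carrier R" "w \<in> carrier R" "z \<oplus>\<^bsub>R\<^esub> w = \<one>\<^bsub>R\<^esub>"
    then have "h z \<oplus>\<^bsub>S\<^esub> h w = \<one>\<^bsub>S\<^esub>" using h.hom_add[of z w] by simp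
    then obtain c' d' where cd': "c' \<in> carrier S" "d' \<in> carrier S"
      "(c' \<otimes>\<^bsub>S\<^esub> h z) \<otimes>\<^bsub>S\<^esub> (d' \<otimes>\<^bsub>S\<^esub> h w) = \<zero>\<^bsub>S\<^esub>" "(c' \<otimes>\<^bsub>S\<^esub> h z) \<oplus>\<^bsub>S\<^esub> (d' \<otimes>\<^bsub>S\<^esub> h w) = \<one>\<^bsub>S\<^esub>"
      using assms(4) zw h.hom_closed unfolding exchange_ring_def by metis
    then obtain c d where cd: "c \<in> carrier R" "d \<in> carrier R" "c' = h c" "d' = h d"
      using bij by (metis bij_betw_def imageE)
    show "\<exists>c\<in>carrier R. \<exists>d\<in>carrier R. (c \<otimes>\<^bsub>R\<^esub> z) \<otimes>\<^bsub>R\<^esub> (d \<otimes>\<^bsub>R\<^esub> w) = \<zero>\<^bsub>R\<^esub> \<and>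
        (c \<otimes>\<^bsub>R\<^esub> z) \<oplus>\<^bsub>R\<^esub> (d \<otimes>\<^bsub>R\<^esub> w) = \<one>\<^bsub>R\<^esub>"
      using cd cd' zw by (intro bexI[of _ c] bexI[of _ d] conjI inj) auto
  qed
qed

lemma exchange_ring_RDirProd:
  assumes "exchange_ring R" "exchange_ring S"
  shows "exchange_ring (RDirProd R S)"
  unfolding exchange_ring_def
proof (intro ballI impI)
  fix z w assume "z \<in> carrier (RDirProd R S)" "w \<in> carrier (RDirProd R S)"
    "z \<oplus>\<^bsub>RDirProd R S\<^esub> w = \<one>\<^bsub>RDirProd R S\<^esub>"
  then obtain z1 z2 w1 w2 where zw: "z = (z1, z2)" "w = (w1, w2)"
    "z1 \<in> carrier R" "w1 \<in> carrier R" "z1 \<oplus>\<^bsub>R\<^esub> w1 = \<one>\<^bsub>R\<^esub>"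
    "z2 \<in> carrier S" "w2 \<in> carrier S" "z2 \<oplus>\<^bsub>S\<^esub> w2 = \<one>\<^bsub>S\<^esub>"
    by (cases z; cases w) (auto simp: RDirProd_def DirProd_def monoid.defs)
  obtain c1 d1 where 1: "c1 \<in> carrier R" "d1 \<in> carrier R"
    "(c1 \<otimes>\<^bsub>R\<^esub> z1) \<otimes>\<^bsub>R\<^esub> (d1 \<otimes>\<^bsub>R\<^esub> w1) = \<zero>\<^bsub>R\<^esub>" "(c1 \<otimes>\<^bsub>R\<^esub> z1) \<oplus>\<^bsub>R\<^esub> (d1 \<otimes>\<^bsub>R\<^esub> w1) = \<one>\<^bsub>R\<^esub>"
    using assms(1) zw(3-5) unfolding exchange_ring_def by metis
  obtain c2 d2 where 2: "c2 \<in> carrier S" "d2 \<in> carrier S"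
    "(c2 \<otimes>\<^bsub>S\<^esub> z2) \<otimes>\<^bsub>S\<^esub> (d2 \<otimes>\<^bsub>S\<^esub> w2) = \<zero>\<^bsub>S\<^esub>" "(c2 \<otimes>\<^bsub>S\<^esub> z2) \<oplus>\<^bsub>S\<^esub> (d2 \<otimes>\<^bsub>S\<^esub> w2) = \<one>\<^bsub>S\<^esub>"
    using assms(2) zw(6-8) unfolding exchange_ring_def by metis
  show "\<exists>c\<in>carrier (RDirProd R S). \<exists>d\<in>carrier (RDirProd R S).
      (c \<otimes>\<^bsub>RDirProd R S\<^esub> z) \<otimes>\<^bsub>RDirProd R S\<^esub> (d \<otimes>\<^bsub>RDirProd R S\<^esub> w) = \<zero>\<^bsub>RDirProd R S\<^esub> \<and>
      (c \<otimes>\<^bsub>RDirProd R S\<^esub> z) \<oplus>\<^bsub>RDirProd R S\<^esub> (d \<otimes>\<^bsub>RDirProd R S\<^esub> w) = \<one>\<^bsub>RDirProd R S\<^esub>"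
    using 1 2 by (intro bexI[of _ "(c1, c2)"] bexI[of _ "(d1, d2)"])
      (auto simp: zw RDirProd_def DirProd_def monoid.defs)
qed

lemma exchange_ring_RDirProd_list:
  assumes "\<And>L. L \<in> set Rs \<Longrightarrow> ring L" "\<And>L. L \<in> set Rs \<Longrightarrow> exchange_ring L"
  shows "exchange_ring (RDirProd_list Rs)"
  using assms
proof (induct Rs)
  case Nil
  \<comment> \<open>The empty product is the zero ring, in which both equations hold
    trivially.\<close>
  then show ?case by (auto simp: exchange_ring_def monoid.defs)
next
  case (Cons R Rs)
  \<comment> \<open>Stated for an arbitrary list \<open>Ls\<close> so that it serves both the full
    product and the product of the tail.\<close>
  have "ring (Ls ! i)" if "set Ls \<subseteq> set (R # Rs)" "i < length Ls" for Ls i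
    using Cons(2) that nth_mem by blast
  then have "ring (RDirProd_list (R # Rs))" "ring (RDirProd_list Rs)"
    by (auto intro: RDirProd_list_is_ring)
  then have rings: "ring (RDirProd_list (R # Rs))" "ring (RDirProd R (RDirProd_list Rs))"
    using Cons(2) RDirProd_ring by auto
  show ?case
    by (rule exchange_ring_iso[OF rings RDirProd_list_iso2 exchange_ring_RDirProd]) (simp_all add: Cons)
qed


section \<open>Algebras over a Hensel local ring\<close>

lemma hensel_finite_algebra_exchange_ring:
  assumes "hensel_local_ring R" "finite_algebra R M"
  shows "exchange_ring M"
proof -
  interpret M: algebra R M using assms(2) by (simp add: finite_algebra_def)
  obtain Rs :: "'a list set ring list" and h
    where Rs: "\<forall>L\<in>set Rs. local_ring L" "h \<in> ring_iso M (RDirProd_list Rs)"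
    using hensel_local_ring_finite_algebra[OF assms] by (auto simp: is_ring_iso_def)
  have rings: "ring L" if "L \<in> set Rs" for L
    using Rs(1) that by (auto simp: local_ring_def cring_def)
  show ?thesis
  proof (rule exchange_ring_iso[OF _ _ Rs(2)])
    show "ring M" by (rule M.ring_axioms)
    show "ring (RDirProd_list Rs)" using rings by (intro RDirProd_list_is_ring) simp
    show "exchange_ring (RDirProd_list Rs)"
      using Rs(1) rings by (intro exchange_ring_RDirProd_list local_ring_exchange_ring) auto
  qed
qed

section \<open>The finite subalgebra generated by an integral element\<close>

lemma (in cring) finite_algebra_ideal_prod:
  assumes A: "subring A R" and D: "subring D R" and P: "finite P" "P \<subseteq> D" and AD: "A \<subseteq> D"
    and gen: "D = A \<cdot> P"
  shows "finite_algebra (R\<lparr>carrier := A\<rparr>) ((self_module R)\<lparr>carrier := D\<rparr>)"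
    (is "finite_algebra ?A ?M")
proof -
  note As = subringE[OF A] and Ds = subringE[OF D]
  have cring: "cring (R\<lparr>carrier := H\<rparr>)" if "subring H R" for H
    using subcring_iff[OF subringE(1)[OF that]] subcringI'[OF that] by simp
  \<comment> \<open>The subring \<open>D\<close> and the module record \<open>?M\<close> have the
    same ring operations, so the identity carries the ring axioms over.\<close>
  have "(\<lambda>x. x) \<in> ring_iso (R\<lparr>carrier := D\<rparr>) ?M"
    by (simp add: ring_iso_def ring_hom_def self_module_def bij_betw_def inj_on_def)
  from cring.ring_iso_imp_img_cring[OF cring[OF D] this] have M: "cring ?M"
    by (simp add: self_module_def)
  have alg: "algebra ?A ?M"
    by (rule algebraI[OF cring[OF A] M])
      (use AD As Ds in \<open>auto simp: self_module_def subset_iff l_distr r_distr m_assoc\<close>)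
  interpret M: algebra ?A ?M by (rule alg)
  \<comment> \<open>Elements of \<open>A \<cdot> P\<close> are sums of single products
    \<open>a \<otimes> p\<close>, in which the same \<open>p\<close> may recur. Collecting terms
    gives one coefficient for each element of \<open>P\<close>: a single product has one coefficient
    \<open>a\<close> and zeros elsewhere, and coefficient functions add.\<close>
  have "\<exists>c\<in>P \<rightarrow> A. x = (\<Oplus>\<^bsub>?M\<^esub>s\<in>P. c s \<odot>\<^bsub>?M\<^esub> s)" if "x \<in> A \<cdot> P" for x using that
  proof induct
    case (prod a p)
    have "a \<odot>\<^bsub>?M\<^esub> p = (\<Oplus>\<^bsub>?M\<^esub>s\<in>P. if p = s then a \<odot>\<^bsub>?M\<^esub> s else \<zero>\<^bsub>?M\<^esub>)"
      by (rule M.finsum_singleton[symmetric])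
        (use prod P M.smult_closed in auto)
    also have "\<dots> = (\<Oplus>\<^bsub>?M\<^esub>s\<in>P. (if p = s then a else \<zero>) \<odot>\<^bsub>?M\<^esub> s)"
      using prod P AD M.smult_closed Ds
      by (intro M.finsum_cong') (auto simp: self_module_def subset_iff)
    finally show ?case
      using prod As by (intro bexI[of _ "\<lambda>s. if p = s then a else \<zero>"]) (auto simp: self_module_def)
  next
    case (sum x y)
    then obtain c d where c: "c \<in> P \<rightarrow> A" "x = (\<Oplus>\<^bsub>?M\<^esub>s\<in>P. c s \<odot>\<^bsub>?M\<^esub> s)"
      and d: "d \<in> P \<rightarrow> A" "y = (\<Oplus>\<^bsub>?M\<^esub>s\<in>P. d s \<odot>\<^bsub>?M\<^esub> s)" by blast
    have cl: "(\<lambda>s. c s \<odot>\<^bsub>?M\<^esub> s) \<in> P \<rightarrow> carrier ?M" "(\<lambda>s. d s \<odot>\<^bsub>?M\<^esub> s) \<in> P \<rightarrow> carrier ?M"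
      using c(1) d(1) P(2) AD Ds(6) by (auto simp: self_module_def Pi_iff subset_iff)
    have "x \<oplus> y = x \<oplus>\<^bsub>?M\<^esub> y" by (simp add: self_module_def)
    also have "\<dots> = (\<Oplus>\<^bsub>?M\<^esub>s\<in>P. c s \<odot>\<^bsub>?M\<^esub> s \<oplus>\<^bsub>?M\<^esub> d s \<odot>\<^bsub>?M\<^esub> s)"
      unfolding c(2) d(2) by (rule M.finsum_addf[OF cl, symmetric])
    also have "\<dots> = (\<Oplus>\<^bsub>?M\<^esub>s\<in>P. (c s \<oplus> d s) \<odot>\<^bsub>?M\<^esub> s)"
      using c(1) d(1) P AD As Ds
      by (intro M.finsum_cong') (auto simp: self_module_def Pi_iff subset_iff l_distr)
    finally show ?case using c(1) d(1) As(7) by (intro bexI[of _ "\<lambda>s. c s \<oplus> d s"]) (simp_all add: Pi_iff)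
  qed
  then show ?thesis unfolding finite_algebra_def
    using alg P by (auto simp: gen self_module_def intro!: exI[of _ P])
qed

text \<open>\<open>A \<cdot> P\<close> is the ring generated by \<open>A\<close> and
  \<open>z\<close>. The monic equation puts the first power of \<open>z\<close> beyond
  \<open>P\<close> into this \<open>A\<close>-span. The span is therefore stable under
  multiplication by \<open>z\<close>, then by every power of \<open>z\<close>, and finally by its
  own elements.\<close>

lemma (in cring) subring_adjoin_integral:
  assumes A: "subring A R" and z: "z \<in> carrier R"
    and as: "set as \<subseteq> A" "eval (\<one> # as) z = \<zero>"
  defines "P \<equiv> (\<lambda>j. z [^] j) ` {..length as}"
  shows "subring (A \<cdot> P) R" and "A \<subseteq> A \<cdot> P" and "P \<subseteq> A \<cdot> P" and "z \<in> A \<cdot> P"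
proof -
  note As = subringE[OF A]
  let ?D = "A \<cdot> P" and ?N = "length as"
  have P: "P \<subseteq> carrier R" using z by (auto simp: P_def)
  have D: "?D \<subseteq> carrier R"
    by (rule ideal_prod_subset) (use P As(1) in \<open>auto simp: add.subgroup_self\<close>)
  have PI: "z [^] j \<in> P" if "j \<le> ?N" for j using that by (auto simp: P_def)
  have one: "\<one> \<in> P" using PI[of 0] by simp
  show AD: "A \<subseteq> ?D"
  proof
    fix a assume "a \<in> A"
    then show "a \<in> ?D" using ideal_prod.prod[of a A \<one> P R] one As(1) by (simp add: subset_iff)
  qed
  show PD: "P \<subseteq> ?D"
  proof
    fix p assume "p \<in> P"
    then show "p \<in> ?D" using ideal_prod.prod[of \<one> A p P R] P As(3) by (simp add: subset_iff)
  qed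
  have sm: "a \<otimes> x \<in> ?D" if a: "a \<in> A" and "x \<in> ?D" for a x using that(2)
  proof induct
    case (prod b p)
    have "a \<otimes> (b \<otimes> p) = (a \<otimes> b) \<otimes> p" using prod a As(1) P by (simp add: m_assoc subset_iff)
    then show ?case using prod a As(6) by (simp add: ideal_prod.prod)
  next
    case (sum x y)
    then have "a \<otimes> (x \<oplus> y) = a \<otimes> x \<oplus> a \<otimes> y" using a As(1) D by (simp add: r_distr subset_iff)
    then show ?case using sum by (simp add: ideal_prod.sum)
  qed
  have neg: "\<ominus> x \<in> ?D" if "x \<in> ?D" for x
  proof -
    have "\<ominus> x = (\<ominus> \<one>) \<otimes> x" using that D by (simp add: l_minus subset_iff)
    then show ?thesis using sm[of "\<ominus> \<one>" x] that As(3,5) by simp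
  qed
  \<comment> \<open>A list of at most \<open>Suc ?N\<close> coefficients involves only exponents up
    to \<open>?N\<close>, and these powers all lie in \<open>P\<close>.\<close>
  have ev: "eval p z \<in> ?D" if "set p \<subseteq> A" "length p \<le> Suc ?N" for p using that
  proof (induct p)
    case Nil
    then show ?case using AD As(2) by auto
  next
    case (Cons a p)
    have "a \<otimes> z [^] length p \<in> ?D" using Cons PI by (intro ideal_prod.prod) auto
    then show ?case using Cons by (simp add: ideal_prod.sum)
  qed
  have carr: "set as \<subseteq> carrier R" using as(1) As(1) by simp
  \<comment> \<open>Appending the constant coefficient \<open>\<zero>\<close> multiplies the monic
    equation by \<open>z\<close>. Its leading power becomes \<open>Suc ?N\<close>, just beyond
    \<open>P\<close>, and moving the remaining terms to the other side expresses it through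
    \<open>P\<close>.\<close>
  have top: "z [^] Suc ?N \<in> ?D"
  proof -
    have "\<zero> = eval ((\<one> # as) @ [\<zero>]) z"
      using eval_append_aux[of "\<one> # as" \<zero> z] carr z as(2) by simp
    also have "\<dots> = z [^] Suc ?N \<oplus> eval (as @ [\<zero>]) z" using z by simp
    finally have "z [^] Suc ?N \<oplus> eval (as @ [\<zero>]) z = \<zero>" ..
    then have "z [^] Suc ?N = \<ominus> (eval (as @ [\<zero>]) z)"
      using eval_in_carrier[of "as @ [\<zero>]" z] carr z by (simp add: minus_equality)
    then show ?thesis using neg ev[of "as @ [\<zero>]"] as(1) As(2) by simp
  qed
  have zD: "z \<otimes> x \<in> ?D" if "x \<in> ?D" for x using that
  proof induct
    case (prod a p)
    then obtain j where j: "j \<le> ?N" "p = z [^] j" by (auto simp: P_def)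
    \<comment> \<open>Only for \<open>j = ?N\<close> does the next power leave \<open>P\<close>;
      that case is \<open>top\<close>.\<close>
    have "z [^] Suc j \<in> ?D" using top PI[of "Suc j"] PD j(1) by (cases "j = ?N") auto
    moreover have "z \<otimes> (a \<otimes> p) = a \<otimes> z [^] Suc j"
      using prod(1) As(1) z j(2) by (simp add: m_ac subset_iff)
    ultimately show ?case using sm prod(1) by simp
  next
    case (sum x y)
    then have "z \<otimes> (x \<oplus> y) = z \<otimes> x \<oplus> z \<otimes> y" using z D by (simp add: r_distr subset_iff)
    then show ?case using sum by (simp add: ideal_prod.sum)
  qed
  have zjD: "z [^] (j::nat) \<otimes> x \<in> ?D" if "x \<in> ?D" for j x
  proof (induct j)
    case 0
    then show ?case using that D by (simp add: subset_iff)
  next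
    case (Suc j)
    have "z [^] Suc j \<otimes> x = z \<otimes> (z [^] j \<otimes> x)" using z that D by (simp add: m_ac subset_iff)
    then show ?case using zD[OF Suc] by simp
  qed
  have mult: "x \<otimes> y \<in> ?D" if "x \<in> ?D" and y: "y \<in> ?D" for x y using that(1)
  proof induct
    case (prod a p)
    then obtain j :: nat where j: "p = z [^] j" by (auto simp: P_def)
    have "(a \<otimes> p) \<otimes> y = a \<otimes> (z [^] j \<otimes> y)"
      using prod j As(1) z y D by (simp add: m_assoc subset_iff)
    then show ?case using sm zjD prod y by simp
  next
    case (sum x x')
    then have "(x \<oplus> x') \<otimes> y = x \<otimes> y \<oplus> x' \<otimes> y" using y D by (simp add: l_distr subset_iff)
    then show ?case using sum by (simp add: ideal_prod.sum)
  qed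
  show "subring ?D R"
    by (rule subringI) (use D neg mult ideal_prod.sum AD As(3) in auto)
  show "z \<in> ?D" using zD[of \<one>] AD As(3) z by auto
qed

text \<open>\<open>C\<close> itself may fail to be finite over \<open>A\<close>, but the exchange
  property concerns one pair \<open>z\<close>, \<open>w\<close> at a time. That pair lies in the
  subalgebra generated by \<open>z\<close>, which is finite over \<open>A\<close> by integrality and
  contained in \<open>C\<close>, so the multipliers found there also work in
  \<open>C\<close>.\<close>

lemma (in cring) hensel_integral_exchange_ring:
  assumes "hensel_local_ring (R\<lparr>carrier := A\<rparr>)" and int: "integral_extension A R"
    and C: "subring C R" and AC: "A \<subseteq> C"
  shows "exchange_ring (R\<lparr>carrier := C\<rparr>)"
proof -
  note Cs = subringE[OF C]
  have A: "subring A R" using int by (simp add: integral_extension_def)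
  have "\<exists>c\<in>C. \<exists>d\<in>C. (c \<otimes> z) \<otimes> (d \<otimes> w) = \<zero> \<and> (c \<otimes> z) \<oplus> (d \<otimes> w) = \<one>"
    if zw: "z \<in> C" "w \<in> C" "z \<oplus> w = \<one>" for z w
  proof -
    have car: "z \<in> carrier R" "w \<in> carrier R" using zw Cs(1) by auto
    obtain as where as: "set as \<subseteq> A" "eval (\<one> # as) z = \<zero>"
      using int car(1) by (auto simp: integral_extension_def)
    let ?P = "(\<lambda>j. z [^] j) ` {..length as}"
    let ?D = "A \<cdot> ?P"
    note D = subring_adjoin_integral[OF A car(1) as]
    note Ds = subringE[OF D(1)]
    have "z [^] (j::nat) \<in> C" for j using Cs(3,6) zw(1) by (induct j) auto
    then have DC: "?D \<subseteq> C"
      using C AC Cs(6) by (intro ideal_prod_subset) (auto simp: subring_def subset_iff)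
    \<comment> \<open>Since \<open>w\<close> is \<open>\<one>\<close> minus \<open>z\<close>,
      adjoining \<open>z\<close> alone captures the whole pair.\<close>
    have "w = \<one> \<oplus> \<ominus> z" using zw(3) car by (metis add.inv_solve_left add.m_comm a_inv_closed one_closed)
    then have "w \<in> ?D" using Ds(3,5,7) D(4) by simp
    moreover have "exchange_ring ((self_module R)\<lparr>carrier := ?D\<rparr>)"
      by (rule hensel_finite_algebra_exchange_ring[OF assms(1) finite_algebra_ideal_prod])
        (use A D in auto)
    ultimately have "\<exists>c\<in>?D. \<exists>d\<in>?D. (c \<otimes> z) \<otimes> (d \<otimes> w) = \<zero> \<and> (c \<otimes> z) \<oplus> (d \<otimes> w) = \<one>"
      using D(4) zw(3) by (simp add: exchange_ring_def self_module_def)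
    then show ?thesis using DC by blast
  qed
  then show ?thesis by (simp add: exchange_ring_def)
qed


section \<open>Invertible submodules over an exchange ring\<close>

text \<open>After expansion the mixed terms contain \<open>f \<otimes> g = \<zero>\<close>, while
  the other two reduce to \<open>f \<otimes> f \<otimes> f\<close> and
  \<open>g \<otimes> g \<otimes> g\<close>.\<close>

lemma (in cring) glue_idempotents:
  assumes car: "f \<in> carrier R" "g \<in> carrier R" "u \<in> carrier R" "u' \<in> carrier R" "v \<in> carrier R" "v' \<in> carrier R"
    and fg: "f \<otimes> f = f" "g \<otimes> g = g" "f \<otimes> g = \<zero>" and uv: "u \<otimes> v = f" "u' \<otimes> v' = g"
  shows "(f \<otimes> u \<oplus> g \<otimes> u') \<otimes> (f \<otimes> v \<oplus> g \<otimes> v') = f \<oplus> g"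
proof -
  have s: "(x \<otimes> p) \<otimes> (y \<otimes> q) = (x \<otimes> y) \<otimes> (p \<otimes> q)"
    if "x \<in> carrier R" "y \<in> carrier R" "p \<in> carrier R" "q \<in> carrier R" for x y p q
    using that by (simp add: m_ac)
  have gf: "g \<otimes> f = \<zero>" using fg(3) car by (simp add: m_comm)
  show ?thesis using car by (simp add: l_distr r_distr s fg gf uv)
qed

text \<open>Induction on the way \<open>w\<close> is built from products. The claim covers all
  idempotent multiples \<open>e\<close> of \<open>w\<close>, because in the sum case
  \<open>e\<close> is split into orthogonal idempotents, one a multiple of each summand; the
  induction hypotheses apply to these and the resulting factors are glued.\<close>

lemma (in cring) idempotent_in_ideal_prod:
  assumes C: "subring C R" and exch: "exchange_ring (R\<lparr>carrier := C\<rparr>)"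
    and I: "submodule_of_ext I C R" and J: "submodule_of_ext J C R" and IJ: "I \<cdot> J \<subseteq> C"
    and "w \<in> I \<cdot> J" "c \<in> C" "e = c \<otimes> w" "e \<otimes> e = e"
  shows "\<exists>u\<in>I. \<exists>v\<in>J. u \<otimes> v = e"
  using assms(6-)
proof (induct w arbitrary: c e)
  case (prod i j)
  have "i \<in> carrier R" "j \<in> carrier R" "c \<in> carrier R"
    using prod I J subringE(1)[OF C] subgroup.subset[of _ "add_monoid R"]
    by (auto simp: submodule_of_ext_iff subset_iff)
  then have "(c \<otimes> i) \<otimes> j = e" using prod by (simp add: m_assoc)
  moreover have "c \<otimes> i \<in> I" using I prod by (simp add: submodule_of_ext_iff)
  ultimately show ?case using prod(2) by blast
next
  case (sum w\<^sub>1 w\<^sub>2)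
  note Cs = subringE[OF C]
  have IJ': "I \<subseteq> carrier R" "J \<subseteq> carrier R" "subgroup I (add_monoid R)" "subgroup J (add_monoid R)"
    using I J subgroup.subset[of _ "add_monoid R"] by (auto simp: submodule_of_ext_iff)
  have w: "w\<^sub>1 \<in> C" "w\<^sub>2 \<in> C" using sum IJ by auto
  have eC: "e \<in> C" using sum(5,6) w Cs by simp
  have car: "c \<in> carrier R" "e \<in> carrier R" "w\<^sub>1 \<in> carrier R" "w\<^sub>2 \<in> carrier R"
    using Cs(1) sum(5) eC w by auto
  \<comment> \<open>The decomposition of \<open>w\<close> induces
    \<open>e = t\<^sub>1 \<oplus> t\<^sub>2\<close>; the extra factor \<open>e\<close> makes
    \<open>e\<close> act as the identity on both parts.\<close>
  define t\<^sub>1 t\<^sub>2 where t: "t\<^sub>1 = e \<otimes> (c \<otimes> w\<^sub>1)" "t\<^sub>2 = e \<otimes> (c \<otimes> w\<^sub>2)"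
  have tC: "t\<^sub>1 \<in> C" "t\<^sub>2 \<in> C" using t eC w sum(5) Cs(6) by auto
  have tcar: "t\<^sub>1 \<in> carrier R" "t\<^sub>2 \<in> carrier R" using tC Cs(1) by auto
  have e: "e \<otimes> (c \<otimes> (w\<^sub>1 \<oplus> w\<^sub>2)) = e" using sum(6,7) by simp
  have t12: "t\<^sub>1 \<oplus> t\<^sub>2 = e" using e car by (simp add: t r_distr)
  have et: "e \<otimes> t\<^sub>1 = t\<^sub>1" "e \<otimes> t\<^sub>2 = t\<^sub>2"
    using sum(7) car by (simp_all add: t m_assoc[symmetric])
  \<comment> \<open>The exchange property needs a total of \<open>\<one>\<close> rather than
    \<open>e\<close>, so the complement of \<open>e\<close> is added to \<open>t\<^sub>2\<close>; it
    disappears again on multiplication by \<open>e\<close>.\<close>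
  define w' where "w' = t\<^sub>2 \<oplus> (\<one> \<ominus> e)"
  have w': "w' \<in> C" "w' \<in> carrier R" using tC eC Cs(3,5,7) subsetD[OF Cs(1)] by (simp_all add: w'_def a_minus_def)
  have "t\<^sub>1 \<oplus> w' = e \<oplus> (\<one> \<ominus> e)"
    using tcar car by (simp add: w'_def t12[symmetric] a_assoc)
  also have "\<dots> = \<one>" using car by algebra
  finally have "t\<^sub>1 \<oplus> w' = \<one>" .
  then obtain a d where ad: "a \<in> C" "d \<in> C"
    "(a \<otimes> t\<^sub>1) \<otimes> (d \<otimes> w') = \<zero>" "(a \<otimes> t\<^sub>1) \<oplus> (d \<otimes> w') = \<one>"
    using exch tC(1) w'(1) unfolding exchange_ring_def by simp blast
  define f g where fg: "f = a \<otimes> t\<^sub>1" "g = d \<otimes> w'"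
  have adcar: "a \<in> carrier R" "d \<in> carrier R" using ad(1,2) Cs(1) by auto
  have fgC: "f \<in> C" "g \<in> C" using fg ad tC w' Cs(6) by auto
  have fgcar: "f \<in> carrier R" "g \<in> carrier R" using fgC Cs(1) by auto
  have fg0: "f \<otimes> g = \<zero>" "f \<oplus> g = \<one>" using ad(3,4) by (simp_all add: fg)
  have gf0: "g \<otimes> f = \<zero>" using fg0(1) fgcar by (simp add: m_comm)
  \<comment> \<open>Orthogonality and sum \<open>\<one>\<close> force \<open>f\<close> and
    \<open>g\<close> to be idempotent.\<close>
  have ff: "f \<otimes> f = f"
  proof -
    have "f \<otimes> (f \<oplus> g) = f \<otimes> f" using fgcar fg0(1) r_distr[of f g f] by simp
    then show ?thesis using fgcar fg0(2) by simp
  qed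
  have gg: "g \<otimes> g = g"
  proof -
    have "g \<otimes> (f \<oplus> g) = g \<otimes> g" using fgcar gf0 r_distr[of f g g] by simp
    then show ?thesis using fgcar fg0(2) by simp
  qed
  \<comment> \<open>As a multiple of \<open>t\<^sub>1\<close>, \<open>f\<close> already lies below
    \<open>e\<close>, but \<open>g\<close> may not. Cutting \<open>g\<close> down by
    \<open>e\<close> yields the complement of \<open>f\<close> inside \<open>e\<close>.\<close>
  define h where "h = e \<otimes> g"
  have hC: "h \<in> C" "h \<in> carrier R" using eC fgC Cs(1,6) by (auto simp: h_def)
  have ef: "e \<otimes> f = f"
  proof -
    have "e \<otimes> f = a \<otimes> (e \<otimes> t\<^sub>1)" using car adcar tcar by (simp add: fg m_ac)
    then show ?thesis by (simp add: et fg)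
  qed
  have hh: "h \<otimes> h = h"
  proof -
    have "h \<otimes> h = (e \<otimes> e) \<otimes> (g \<otimes> g)" using car fgcar by (simp add: h_def m_ac)
    then show ?thesis by (simp add: gg sum(7) h_def)
  qed
  have fh: "f \<otimes> h = \<zero>"
  proof -
    have "f \<otimes> h = e \<otimes> (f \<otimes> g)" using car fgcar by (simp add: h_def m_ac)
    then show ?thesis using car by (simp add: fg0)
  qed
  have f_h: "f \<oplus> h = e"
  proof -
    have "f \<oplus> h = e \<otimes> (f \<oplus> g)" using car fgcar by (simp add: r_distr ef h_def)
    then show ?thesis using car by (simp add: fg0)
  qed
  \<comment> \<open>Here \<open>e\<close> kills the added complement, so \<open>h\<close> becomes a
    multiple of \<open>t\<^sub>2\<close> and hence of \<open>w\<^sub>2\<close>.\<close>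
  have "e \<otimes> w' = t\<^sub>2"
  proof -
    have "e \<otimes> w' = e \<otimes> t\<^sub>2 \<oplus> (e \<ominus> e \<otimes> e)" using car tcar unfolding w'_def by algebra
    then show ?thesis using car tcar by (simp add: et sum(7) a_minus_def r_neg)
  qed
  moreover have "h = d \<otimes> (e \<otimes> w')" using car adcar w' by (simp add: h_def fg m_ac)
  ultimately have "h = (d \<otimes> (e \<otimes> c)) \<otimes> w\<^sub>2" using car adcar by (simp add: t m_assoc)
  then obtain u' v' where 2: "u' \<in> I" "v' \<in> J" "u' \<otimes> v' = h"
    using sum(4)[of "d \<otimes> (e \<otimes> c)" h] hh ad(2) eC sum(5) Cs(6) by blast
  have "f = (a \<otimes> (e \<otimes> c)) \<otimes> w\<^sub>1" using car adcar by (simp add: fg t m_assoc)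
  then obtain u v where 1: "u \<in> I" "v \<in> J" "u \<otimes> v = f"
    using sum(2)[of "a \<otimes> (e \<otimes> c)" f] ff ad(1) eC sum(5) Cs(6) by blast
  have "(f \<otimes> u \<oplus> h \<otimes> u') \<otimes> (f \<otimes> v \<oplus> h \<otimes> v') = e"
    using glue_idempotents[of f h u u' v v'] fgcar hC 1 2 IJ' ff hh fh f_h by (simp add: subset_iff)
  moreover have "f \<otimes> u \<oplus> h \<otimes> u' \<in> I" "f \<otimes> v \<oplus> h \<otimes> v' \<in> J"
    using 1 2 I J fgC hC subgroup.m_closed[OF IJ'(3)] subgroup.m_closed[OF IJ'(4)]
    by (simp_all add: submodule_of_ext_iff)
  ultimately show ?case by blast
qed

text \<open>Once \<open>u \<otimes> v = \<one>\<close>, every \<open>x \<in> I\<close> equals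
  \<open>(x \<otimes> v) \<otimes> u\<close>, and its coefficient \<open>x \<otimes> v\<close> lies
  in \<open>I \<cdot> J = C\<close>.\<close>

lemma (in cring) invertible_submodule_principal:
  assumes C: "subring C R" and exch: "exchange_ring (R\<lparr>carrier := C\<rparr>)"
    and I: "submodule_of_ext I C R" and J: "submodule_of_ext J C R" and IJ: "I \<cdot> J = C"
  shows "\<exists>u\<in>I. \<exists>v\<in>J. u \<otimes> v = \<one> \<and> I = (\<lambda>x. x \<otimes> u) ` C"
proof -
  note Cs = subringE[OF C]
  have car: "I \<subseteq> carrier R" "J \<subseteq> carrier R"
    using I J subgroup.subset[of _ "add_monoid R"] by (auto simp: submodule_of_ext_iff)
  obtain u v where uv: "u \<in> I" "v \<in> J" "u \<otimes> v = \<one>"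
    \<comment> \<open>The idempotent to be factored is \<open>\<one>\<close>, regarded as
      \<open>\<one>\<close> times the element \<open>\<one>\<close> of
      \<open>I \<cdot> J\<close>.\<close>
    using idempotent_in_ideal_prod[OF C exch I J, of \<one> \<one> \<one>] IJ Cs(3) by auto
  have "x \<in> (\<lambda>x. x \<otimes> u) ` C" if x: "x \<in> I" for x
  proof
    show "x \<otimes> v \<in> C" using ideal_prod.prod[OF x uv(2), of R] IJ by simp
    have "(x \<otimes> v) \<otimes> u = x \<otimes> (u \<otimes> v)" using x uv(1,2) car by (simp add: m_ac subset_iff)
    then show "x = (x \<otimes> v) \<otimes> u" using x uv car by (simp add: subset_iff)
  qed
  moreover have "(\<lambda>x. x \<otimes> u) ` C \<subseteq> I" using I uv by (auto simp: submodule_of_ext_iff)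
  ultimately show ?thesis using uv by blast
qed

section \<open>Principal submodules and extension of scalars\<close>

lemma (in cring) submodule_of_ext_principal:
  assumes A: "subring A R" and u: "u \<in> carrier R"
  shows "submodule_of_ext ((\<lambda>a. a \<otimes> u) ` A) A R"
proof -
  note As = subringE[OF A]
  have "subgroup ((\<lambda>a. a \<otimes> u) ` A) (add_monoid R)"
  proof (rule add.subgroupI)
    show "(\<lambda>a. a \<otimes> u) ` A \<subseteq> carrier R" using As(1) u by auto
    show "(\<lambda>a. a \<otimes> u) ` A \<noteq> {}" using As(2) by auto
  next
    fix x assume "x \<in> (\<lambda>a. a \<otimes> u) ` A"
    then obtain a where "a \<in> A" "x = a \<otimes> u" by blast
    then show "\<ominus> x \<in> (\<lambda>a. a \<otimes> u) ` A"
      using As(1,5) u by (intro image_eqI[of _ _ "\<ominus> a"]) (auto simp: l_minus)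
  next
    fix x y assume "x \<in> (\<lambda>a. a \<otimes> u) ` A" "y \<in> (\<lambda>a. a \<otimes> u) ` A"
    then obtain a b where "a \<in> A" "x = a \<otimes> u" "b \<in> A" "y = b \<otimes> u" by blast
    then show "x \<oplus> y \<in> (\<lambda>a. a \<otimes> u) ` A"
      using As(1,7) u by (intro image_eqI[of _ _ "a \<oplus> b"]) (auto simp: l_distr subset_iff)
  qed
  moreover have "b \<otimes> (a \<otimes> u) \<in> (\<lambda>a. a \<otimes> u) ` A" if "a \<in> A" "b \<in> A" for a b
    using that As(1,6) u by (intro image_eqI[of _ _ "b \<otimes> a"]) (auto simp: m_assoc subset_iff)
  ultimately show ?thesis by (auto simp: submodule_of_ext_iff)
qed

text \<open>One computation for three uses: \<open>C = A\<close> multiplies two principal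
  \<open>A\<close>-submodules, \<open>v = \<one>\<close> extends scalars from \<open>A\<close> to
  \<open>C\<close>, and \<open>u = v = \<one>\<close> shows that \<open>C\<close> absorbs
  \<open>A\<close>.\<close>

lemma (in cring) ideal_prod_principal:
  assumes A: "A \<subseteq> carrier R" "\<one> \<in> A" and C: "subring C R" and AC: "A \<subseteq> C"
    and u: "u \<in> carrier R" and v: "v \<in> carrier R"
  shows "((\<lambda>a. a \<otimes> u) ` A) \<cdot> ((\<lambda>c. c \<otimes> v) ` C) = (\<lambda>c. c \<otimes> (u \<otimes> v)) ` C"
    (is "?L = ?R")
proof
  note Cs = subringE[OF C]
  have eq: "(a \<otimes> u) \<otimes> (c \<otimes> v) = (a \<otimes> c) \<otimes> (u \<otimes> v)" if "a \<in> A" "c \<in> C" for a c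
    using that A Cs(1) u v by (simp add: m_ac subset_iff)
  have "subgroup ?R (add_monoid R)"
    using submodule_of_ext_principal[OF C, of "u \<otimes> v"] u v by (simp add: submodule_of_ext_iff)
  then show "?L \<subseteq> ?R"
    by (rule ideal_prod_subset) (use eq AC Cs(6) in auto)
  show "?R \<subseteq> ?L"
  proof
    fix x assume "x \<in> ?R"
    then obtain c where c: "c \<in> C" "x = c \<otimes> (u \<otimes> v)" by blast
    then have "x = (\<one> \<otimes> u) \<otimes> (c \<otimes> v)" using eq[OF A(2)] Cs(1) by auto
    then show "x \<in> ?L" using A(2) c(1) by (auto intro!: ideal_prod.prod)
  qed
qed

text \<open>If \<open>J\<close> is inverse to \<open>I\<close>, then \<open>J \<cdot> C\<close> is
  inverse to \<open>I \<cdot> C\<close>: regrouping and \<open>C \<cdot> C = C\<close> reduce their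
  product to \<open>(I \<cdot> J) \<cdot> C = A \<cdot> C = C\<close>.\<close>

lemma (in cring) invertible_submodules_extend:
  assumes A: "subring A R" and C: "subring C R" and AC: "A \<subseteq> C"
    and "I \<in> carrier (invertible_submodules A R)"
  shows "I \<cdot> C \<in> carrier (invertible_submodules C R)"
proof -
  note Cs = subringE[OF C]
  obtain J where I: "subgroup I (add_monoid R)" and J: "subgroup J (add_monoid R)" and IJ: "I \<cdot> J = A"
    using assms(4) by (auto simp: invertible_submodules_def submodule_of_ext_iff)
  have sgC: "subgroup C (add_monoid R)" using C by (simp add: subring_def)
  have modC: "submodule_of_ext C C R" using sgC Cs(6) by (simp add: submodule_of_ext_iff)
  \<comment> \<open>Scalars act through the left factor of a product, so \<open>C\<close> is moved
    to the left first.\<close>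
  have mod: "submodule_of_ext (K \<cdot> C) C R" if "subgroup K (add_monoid R)" for K
    using ideal_prod_submodule_of_ext[OF Cs(1) modC that] ideal_prod_comm_subset[of K C]
      subgroup.subset[OF that] Cs(1) by simp
  have sg: "subgroup (K \<cdot> C) (add_monoid R)" if "subgroup K (add_monoid R)" for K
    using mod[OF that] by (simp add: submodule_of_ext_iff)
  have HC: "H \<cdot> C = C" if "H \<subseteq> C" "\<one> \<in> H" for H
    using ideal_prod_principal[of H C \<one> \<one>] that C Cs(1) by (simp add: subset_iff image_iff)
  have "(I \<cdot> C) \<cdot> (J \<cdot> C) = I \<cdot> (C \<cdot> (J \<cdot> C))" by (rule ideal_prod_assoc_subgroup[OF I sgC sg[OF J]])
  also have "C \<cdot> (J \<cdot> C) = (J \<cdot> C) \<cdot> C"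
    using ideal_prod_comm_subset subgroup.subset[OF sg[OF J]] Cs(1) by simp
  also have "\<dots> = J \<cdot> C" using ideal_prod_assoc_subgroup[OF J sgC sgC] HC[of C] Cs(3) by simp
  also have "I \<cdot> (J \<cdot> C) = C"
    using ideal_prod_assoc_subgroup[OF I J sgC] IJ HC[OF AC] subringE(3)[OF A] by simp
  finally show ?thesis using mod[OF I] mod[OF J] by (auto simp: invertible_submodules_def)
qed

theorem proposition3p2:
  fixes B :: "('b, 'm) ring_scheme" and A C :: "'b set"
  assumes "cring B"
    and "integral_extension A B"
    and "hensel_local_ring (B\<lparr>carrier := A\<rparr>)"
    and "subring C B" and "A \<subseteq> C"
  shows "(\<lambda>I. I \<cdot>\<^bsub>B\<^esub> C) ` carrier (invertible_submodules A B) = carrier (invertible_submodules C B)"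
proof
  interpret cring B by fact
  have A: "subring A B" using assms(2) by (simp add: integral_extension_def)
  note As = subringE[OF A] and Cs = subringE[OF assms(4)]
  show "(\<lambda>I. I \<cdot>\<^bsub>B\<^esub> C) ` carrier (invertible_submodules A B) \<subseteq> carrier (invertible_submodules C B)"
    using invertible_submodules_extend[OF A assms(4,5)] by auto
  have exch: "exchange_ring (B\<lparr>carrier := C\<rparr>)"
    by (rule hensel_integral_exchange_ring[OF assms(3,2,4,5)])
  show "carrier (invertible_submodules C B) \<subseteq> (\<lambda>I. I \<cdot>\<^bsub>B\<^esub> C) ` carrier (invertible_submodules A B)"
  proof
    fix I assume "I \<in> carrier (invertible_submodules C B)"
    then obtain J where J: "submodule_of_ext I C B" "submodule_of_ext J C B" "I \<cdot>\<^bsub>B\<^esub> J = C"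
      by (auto simp: invertible_submodules_def)
    obtain u v where uv: "u \<in> I" "v \<in> J" "u \<otimes>\<^bsub>B\<^esub> v = \<one>\<^bsub>B\<^esub>" "I = (\<lambda>x. x \<otimes>\<^bsub>B\<^esub> u) ` C"
      using invertible_submodule_principal[OF assms(4) exch J] by blast
    have car: "u \<in> carrier B" "v \<in> carrier B"
      using uv(1,2) J(1,2) subgroup.subset[of _ "add_monoid B"] by (auto simp: submodule_of_ext_iff)
    \<comment> \<open>The generator \<open>u\<close> of \<open>I\<close> over \<open>C\<close> also
      generates the preimage over \<open>A\<close>; \<open>?J\<close> is its inverse because
      \<open>u\<close> and \<open>v\<close> have product \<open>\<one>\<close>.\<close>
    let ?I = "(\<lambda>a. a \<otimes>\<^bsub>B\<^esub> u) ` A" and ?J = "(\<lambda>a. a \<otimes>\<^bsub>B\<^esub> v) ` A"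
    have one: "(\<lambda>x. x \<otimes>\<^bsub>B\<^esub> \<one>\<^bsub>B\<^esub>) ` H = H" if "H \<subseteq> carrier B" for H
      using that by (force simp: subset_iff image_iff)
    have "?I \<cdot>\<^bsub>B\<^esub> ?J = A"
      using ideal_prod_principal[OF As(1,3) A _ car] one[OF As(1)] by (simp add: uv(3))
    then have "?I \<in> carrier (invertible_submodules A B)"
      using submodule_of_ext_principal[OF A car(1)] submodule_of_ext_principal[OF A car(2)]
      by (auto simp: invertible_submodules_def)
    moreover have "?I \<cdot>\<^bsub>B\<^esub> C = I"
      using ideal_prod_principal[OF As(1,3) assms(4,5) car(1) one_closed] one[OF Cs(1)] car
      by (simp add: uv(4))
    ultimately show "I \<in> (\<lambda>I. I \<cdot>\<^bsub>B\<^esub> C) ` carrier (invertible_submodules A B)" by blast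
  qed
qed

end
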